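(* There exists an absolute constant $c>0$ such that the following holds. Let $r$ be a positive integer and let $M\in\{0,1\}^{n\times n}$ with $\operatorname{rank}(M)\leq r$ and $p(M)\leq 1/2$. Then $z(M)\geq n/2^{c\sqrt r}$.
   Context: $p(M)=|M|/n^2$, where $|M|$ is the number of $1$ entries. $z(M)$ is the largest $z$ for which there exist $X,Y\subset[n]$ with $|X|=|Y|=z$ such that the submatrix $M[X\times Y]$ (rows $X$, columns $Y$) has only $0$ entries. *)

theory Defs
  imports "Jordan_Normal_Form.DL_Rank" "HOL-Analysis.Analysis"
begin

definition real_rank :: "real mat \<Rightarrow> nat" where
  "real_rank A = vec_space.rank (dim_row A) A"

definition zero_one_mat :: "real mat \<Rightarrow> bool" where
  "zero_one_mat M \<longleftrightarrow> (\<forall>i < dim_row M. \<forall>j < dim_col M. M $$ (i,j) = 0 \<or> M $$ (i,j) = 1)"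

definition density :: "real mat \<Rightarrow> real" where
  "density M = real (card {(i,j). i < dim_row M \<and> j < dim_col M \<and> M $$ (i,j) = 1})
               / (real (dim_row M))^2"

definition zero_rect :: "real mat \<Rightarrow> nat set \<Rightarrow> nat set \<Rightarrow> bool" where
  "zero_rect M X Y \<longleftrightarrow> X \<subseteq> {..<dim_row M} \<and> Y \<subseteq> {..<dim_col M} \<and>
     (\<forall>i\<in>X. \<forall>j\<in>Y. M $$ (i,j) = 0)"

definition zarank :: "real mat \<Rightarrow> nat" where
  "zarank M = Max {z. \<exists>X Y. zero_rect M X Y \<and> card X = z \<and> card Y = z}"

end

theory Submission
  imports Defs
begin

text \<open>
  A rectangle of density \<open>p \<ge> 1/(4r)\<close> contains a subrectangle with at least
  \<open>c sqrt(p/r)\<close> times its area fewer ones than expected. To see this, write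
  \<open>M i j = u i \<bullet> w j\<close> with \<open>w\<close> coming from an orthonormal basis of the row space. After
  dropping the rows with more than \<open>4pn\<close> ones and the columns with \<open>|w j|^2 > 4r/n\<close>, the rescaled
  \<open>u i\<close> and \<open>w j\<close> are feasible vectors for the semidefinite relaxation of the discrepancy of
  \<open>M - p\<close>, of value of order \<open>sqrt(p/r)\<close> times the area; Grothendieck's inequality rounds them.

  If such a subrectangle has a fraction \<open>t\<close> of the area, its density drops by
  \<open>c sqrt(p/r) / t\<close>, so that \<open>sqrt(r p)\<close> drops by at least \<open>c/(2t)\<close>, which pays for the factor
  \<open>t \<ge> exp(-1/t)\<close> lost in the side lengths. Iteration costs a factor \<open>exp(O(sqrt r))\<close> in total
  and ends with a rectangle of density at most \<open>1/(4r)\<close>. There, the rows with at most twice the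
  average number of ones are spanned by \<open>r\<close> of them, whose supports miss half of the columns.
\<close>

subsection \<open>Grothendieck's inequality\<close>

text \<open>The Rademacher sum at the sign pattern that is +1 on \<open>A\<close> and -1 off
  \<open>A\<close>; a sum over \<open>Pow K\<close> then stands for \<open>2 ^ card K\<close> times
  an expectation.\<close>

definition signed_sum :: "'k set \<Rightarrow> 'k set \<Rightarrow> ('k \<Rightarrow> real) \<Rightarrow> real" where
  "signed_sum K A x = (\<Sum>k\<in>K. if k \<in> A then x k else - x k)"

text \<open>Conditioning on the sign of \<open>k\<close>. The test function \<open>F\<close> takes
  two sums so that both mixed second moments and fourth moments fit.\<close>

lemma sum_signed_sum_insert:
  assumes "finite K" "k \<notin> K"
  shows "(\<Sum>A\<in>Pow (insert k K). F (signed_sum (insert k K) A x) (signed_sum (insert k K) A y)) =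
    (\<Sum>A\<in>Pow K. F (signed_sum K A x + x k) (signed_sum K A y + y k)
      + F (signed_sum K A x - x k) (signed_sum K A y - y k) :: real)"
proof -
  have inj: "inj_on (insert k) (Pow K)"
    using assms(2) by (auto simp: inj_on_def)
  have disj: "Pow K \<inter> insert k ` Pow K = {}"
    using assms(2) by auto
  have 1: "signed_sum (insert k K) (insert k A) z = signed_sum K A z + z k" for A z
    unfolding signed_sum_def using assms by (auto intro!: sum.cong)
  have 2: "signed_sum (insert k K) A z = signed_sum K A z - z k" if "A \<in> Pow K" for A z
    unfolding signed_sum_def using assms that by (auto intro!: sum.cong)
  show ?thesis
    unfolding Pow_insert
    by (subst sum.union_disjoint)
      (use assms disj inj 1 2 in \<open>auto simp: sum.reindex sum.distrib intro!: sum.cong\<close>)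
qed

lemma signed_sum_second_moment:
  assumes "finite K"
  shows "(\<Sum>A\<in>Pow K. signed_sum K A x * signed_sum K A y) = 2 ^ card K * (\<Sum>k\<in>K. x k * y k)"
  using assms
proof (induction K)
  case empty
  show ?case by (simp add: signed_sum_def)
next
  case (insert k K)
  have "(\<Sum>A\<in>Pow (insert k K). signed_sum (insert k K) A x * signed_sum (insert k K) A y) =
     (\<Sum>A\<in>Pow K. 2 * (signed_sum K A x * signed_sum K A y) + 2 * (x k * y k))"
    by (subst sum_signed_sum_insert[where F = "\<lambda>u v. u * v", OF insert(1,2)])
      (simp add: algebra_simps)
  also have "\<dots> = 2 * (2 ^ card K * (\<Sum>k\<in>K. x k * y k)) + 2 * (2 ^ card K * (x k * y k))"
    using insert by (simp add: sum.distrib flip: sum_distrib_left) (simp add: card_Pow)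
  finally show ?case
    using insert(1,2) by (simp add: algebra_simps)
qed

text \<open>Khinchine's inequality for exponent 4. Odd powers of the new term cancel, and the
  recursion falls short of the required square by exactly
  \<open>2 ^ card K * (4 * x k ^ 4)\<close>.\<close>

lemma signed_sum_fourth_moment:
  assumes "finite K"
  shows "(\<Sum>A\<in>Pow K. signed_sum K A x ^ 4) \<le> 3 * 2 ^ card K * (\<Sum>k\<in>K. (x k)\<^sup>2)\<^sup>2"
  using assms
proof (induction K)
  case empty
  show ?case by (simp add: signed_sum_def)
next
  case (insert k K)
  define s where "s = (\<Sum>k\<in>K. (x k)\<^sup>2)"
  define R where "R A = signed_sum K A x" for A
  have m2: "(\<Sum>A\<in>Pow K. (R A)\<^sup>2) = 2 ^ card K * s"
    using signed_sum_second_moment[OF insert(1), of x x] by (simp add: power2_eq_square R_def s_def)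
  have "(\<Sum>A\<in>Pow (insert k K). signed_sum (insert k K) A x ^ 4) =
     (\<Sum>A\<in>Pow K. (R A + x k) ^ 4 + (R A - x k) ^ 4)"
    using sum_signed_sum_insert[where F = "\<lambda>u v. u ^ 4", OF insert(1,2)] by (simp add: R_def)
  also have "\<dots> = (\<Sum>A\<in>Pow K. 2 * R A ^ 4 + 12 * (x k)\<^sup>2 * (R A)\<^sup>2 + 2 * x k ^ 4)"
    by (intro sum.cong) (auto simp: algebra_simps power2_eq_square power4_eq_xxxx)
  also have "\<dots> = 2 * (\<Sum>A\<in>Pow K. R A ^ 4) + 12 * (x k)\<^sup>2 * (\<Sum>A\<in>Pow K. (R A)\<^sup>2) + 2 ^ card K * (2 * x k ^ 4)"
    using insert(1) by (simp add: sum.distrib sum_distrib_left card_Pow)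
  also have "\<dots> \<le> 2 * (3 * 2 ^ card K * s\<^sup>2) + 12 * (x k)\<^sup>2 * (2 ^ card K * s) + 2 ^ card K * (2 * x k ^ 4)"
    using insert.IH m2 by (simp add: R_def s_def)
  also have "\<dots> \<le> 3 * 2 ^ Suc (card K) * (s + (x k)\<^sup>2)\<^sup>2"
  proof -
    have "3 * 2 ^ Suc (card K) * (s + (x k)\<^sup>2)\<^sup>2 - (2 * (3 * 2 ^ card K * s\<^sup>2)
        + 12 * (x k)\<^sup>2 * (2 ^ card K * s) + 2 ^ card K * (2 * x k ^ 4)) = 2 ^ card K * (4 * x k ^ 4)"
      by (simp add: algebra_simps power2_eq_square power4_eq_xxxx)
    also have "\<dots> \<ge> 0" by simp
    finally show ?thesis by linarith
  qed
  finally show ?case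
    using insert(1,2) by (simp add: s_def algebra_simps)
qed

section \<open>From vectors to signs\<close>

text \<open>A bilinear form on a cube is maximal at a vertex, being linear in each coordinate: first
  \<open>f\<close> is replaced by signs with \<open>g\<close> fixed, then \<open>g\<close>.\<close>

lemma bilinear_le_signs:
  fixes N :: "'a \<Rightarrow> 'b \<Rightarrow> real"
  assumes B: "\<And>s t. (\<And>i. s i \<in> {-1, 1}) \<Longrightarrow> (\<And>j. t j \<in> {-1, 1}) \<Longrightarrow>
      (\<Sum>i\<in>X. \<Sum>j\<in>Y. N i j * (s i * t j)) \<le> B"
    and T: "T \<ge> 0" and f: "\<And>i. \<bar>f i\<bar> \<le> T" and g: "\<And>j. \<bar>g j\<bar> \<le> T"
  shows "(\<Sum>i\<in>X. \<Sum>j\<in>Y. N i j * (f i * g j)) \<le> T\<^sup>2 * B"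
proof -
  have le: "u * v \<le> T * \<bar>v\<bar>" if "\<bar>u\<bar> \<le> T" for u v :: real
    using mult_right_mono[OF that abs_ge_zero[of v]] by (simp flip: abs_mult)
  define s where "s i = (if (\<Sum>j\<in>Y. N i j * g j) \<ge> 0 then 1 else -1 :: real)" for i
  define t where "t j = (if (\<Sum>i\<in>X. N i j * s i) \<ge> 0 then 1 else -1 :: real)" for j
  have "(\<Sum>i\<in>X. \<Sum>j\<in>Y. N i j * (f i * g j)) = (\<Sum>i\<in>X. f i * (\<Sum>j\<in>Y. N i j * g j))"
    by (simp add: sum_distrib_left mult_ac)
  also have "\<dots> \<le> (\<Sum>i\<in>X. T * \<bar>\<Sum>j\<in>Y. N i j * g j\<bar>)"
    by (intro sum_mono le f)
  also have "\<dots> = T * (\<Sum>i\<in>X. s i * (\<Sum>j\<in>Y. N i j * g j))"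
    by (subst sum_distrib_left) (auto simp: s_def intro!: sum.cong)
  also have "(\<Sum>i\<in>X. s i * (\<Sum>j\<in>Y. N i j * g j)) = (\<Sum>i\<in>X. \<Sum>j\<in>Y. g j * (N i j * s i))"
    by (simp add: sum_distrib_left mult_ac)
  also have "\<dots> = (\<Sum>j\<in>Y. g j * (\<Sum>i\<in>X. N i j * s i))"
    by (subst sum.swap) (simp add: sum_distrib_left)
  also have "T * \<dots> \<le> T * (\<Sum>j\<in>Y. T * \<bar>\<Sum>i\<in>X. N i j * s i\<bar>)"
    by (intro mult_left_mono sum_mono le g T)
  also have "\<dots> = T\<^sup>2 * (\<Sum>j\<in>Y. t j * (\<Sum>i\<in>X. N i j * s i))"
    by (subst (1 2) sum_distrib_left) (auto simp: t_def power2_eq_square intro!: sum.cong)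
  also have "(\<Sum>j\<in>Y. t j * (\<Sum>i\<in>X. N i j * s i)) = (\<Sum>j\<in>Y. \<Sum>i\<in>X. N i j * (s i * t j))"
    by (simp add: sum_distrib_left mult_ac)
  also have "\<dots> = (\<Sum>i\<in>X. \<Sum>j\<in>Y. N i j * (s i * t j))"
    by (rule sum.swap)
  also have "T\<^sup>2 * \<dots> \<le> T\<^sup>2 * B"
    by (intro mult_left_mono B) (auto simp: s_def t_def)
  finally show ?thesis .
qed

theorem grothendieck_inequality:
  fixes N :: "'a \<Rightarrow> 'b \<Rightarrow> real" and x :: "'a \<Rightarrow> nat \<Rightarrow> real" and y :: "'b \<Rightarrow> nat \<Rightarrow> real"
  assumes B: "\<And>s t. (\<And>i. s i \<in> {-1, 1}) \<Longrightarrow> (\<And>j. t j \<in> {-1, 1}) \<Longrightarrow>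
      (\<Sum>i\<in>X. \<Sum>j\<in>Y. N i j * (s i * t j)) \<le> B"
    and x: "\<And>i. (\<Sum>k<d. (x i k)\<^sup>2) \<le> 1" and y: "\<And>j. (\<Sum>k<d. (y j k)\<^sup>2) \<le> 1"
  shows "(\<Sum>i\<in>X. \<Sum>j\<in>Y. N i j * (\<Sum>k<d. x i k * y j k)) \<le> 96 * B"
proof -
  \<comment> \<open>The dimension varies within \<open>V\<close>, because the improvement step below
    turns vectors of dimension \<open>d\<close> into vectors indexed by \<open>2 ^ d\<close> sign
    patterns.\<close>
  define V where "V = {v. \<exists>(d::nat) x y. (\<forall>i. (\<Sum>k<d. (x i k)\<^sup>2) \<le> 1) \<and> (\<forall>j. (\<Sum>k<d. (y j k)\<^sup>2) \<le> 1)
     \<and> v = (\<Sum>i\<in>X. \<Sum>j\<in>Y. N i j * (\<Sum>k<d. x i k * y j k))}"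
  define S where "S = Sup V"
  have bdd: "bdd_above V"
  proof (rule bdd_aboveI)
    fix v assume "v \<in> V"
    then obtain d :: nat and x y where x: "\<And>i. (\<Sum>k<d. (x i k)\<^sup>2) \<le> 1" and y: "\<And>j. (\<Sum>k<d. (y j k)\<^sup>2) \<le> 1"
      and v: "v = (\<Sum>i\<in>X. \<Sum>j\<in>Y. N i j * (\<Sum>k<d. x i k * y j k))"
      unfolding V_def by blast
    have "\<bar>\<Sum>k<d. x i k * y j k\<bar> \<le> 1" for i j
    proof -
      have "\<bar>\<Sum>k<d. x i k * y j k\<bar> \<le> L2_set (x i) {..<d} * L2_set (y j) {..<d}"
        using sum_abs[of "\<lambda>k. x i k * y j k" "{..<d}"] L2_set_mult_ineq[of "x i" "y j" "{..<d}"]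
        by (simp add: abs_mult)
      also have "\<dots> \<le> 1 * 1"
        by (intro mult_mono) (auto simp: L2_set_def x y intro: sum_nonneg)
      finally show ?thesis by simp
    qed
    then have "\<bar>N i j * (\<Sum>k<d. x i k * y j k)\<bar> \<le> \<bar>N i j\<bar> * 1" for i j
      unfolding abs_mult by (intro mult_left_mono) auto
    then have "N i j * (\<Sum>k<d. x i k * y j k) \<le> \<bar>N i j\<bar>" for i j
      using abs_ge_self order_trans by fastforce
    then show "v \<le> (\<Sum>i\<in>X. \<Sum>j\<in>Y. \<bar>N i j\<bar>)"
      unfolding v by (intro sum_mono) auto
  qed
  \<comment> \<open>Sign patterns are sets of naturals; enumerating them brings vectors indexed by
    patterns back into the form required by \<open>V\<close>.\<close>
  have ub: "(\<Sum>i\<in>X. \<Sum>j\<in>Y. N i j * (\<Sum>k\<in>K. x i k * y j k)) \<le> S"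
    if K: "finite K" and x: "\<And>i. (\<Sum>k\<in>K. (x i k)\<^sup>2) \<le> 1" and y: "\<And>j. (\<Sum>k\<in>K. (y j k)\<^sup>2) \<le> 1"
    for K :: "nat set set" and x y
  proof -
    obtain h where h: "bij_betw h {..<card K} K"
      using ex_bij_betw_nat_finite[OF K] by (auto simp: atLeast0LessThan)
    have *: "(\<Sum>k\<in>K. F k) = (\<Sum>k<card K. F (h k))" for F :: "nat set \<Rightarrow> real"
      using sum.reindex_bij_betw[OF h, of F] by simp
    have "(\<Sum>i\<in>X. \<Sum>j\<in>Y. N i j * (\<Sum>k\<in>K. x i k * y j k)) \<in> V"
      unfolding V_def using x y
      by (intro CollectI exI[of _ "card K"] exI[of _ "\<lambda>i k. x i (h k)"] exI[of _ "\<lambda>j k. y j (h k)"])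
        (simp add: *)
    then show ?thesis
      unfolding S_def by (rule cSup_upper[OF _ bdd])
  qed
  \<comment> \<open>Replace the vectors by their Rademacher sums, viewed as vectors indexed by the sign patterns,
    and truncate these at \<open>sqrt 48\<close>. By the fourth moment bound the parts cut off have norm at most
    \<open>1/4\<close>, so they are again controlled by the supremum \<open>S\<close>.\<close>
  have improve: "v \<le> 48 * B + S / 2" if v_in: "v \<in> V" for v
  proof -
    obtain d :: nat and x y where x: "\<And>i. (\<Sum>k<d. (x i k)\<^sup>2) \<le> 1" and y: "\<And>j. (\<Sum>k<d. (y j k)\<^sup>2) \<le> 1"
      and v: "v = (\<Sum>i\<in>X. \<Sum>j\<in>Y. N i j * (\<Sum>k<d. x i k * y j k))"
      using v_in unfolding V_def by blast
    define W where "W = Pow {..<d}"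
    define q where "q = sqrt (2 ^ d)"
    define R where "R A z = signed_sum {..<d} A z" for A z
    define F where "F z A = R A z / q" for z A
    define lo where "lo z A = (if \<bar>R A z\<bar> \<le> sqrt 48 then F z A else 0)" for z A
    define hi where "hi z A = F z A - lo z A" for z A
    have fW: "finite W" by (simp add: W_def)
    have q: "q > 0" "q\<^sup>2 = 2 ^ d" by (auto simp: q_def)
    have FF: "(\<Sum>A\<in>W. F z A * F z' A) = (\<Sum>k<d. z k * z' k)" for z z'
      using signed_sum_second_moment[of "{..<d}" z z'] q
      by (simp add: F_def W_def R_def power2_eq_square flip: sum_divide_distrib)
    have F1: "(\<Sum>A\<in>W. (F z A)\<^sup>2) \<le> 1" if "(\<Sum>k<d. (z k)\<^sup>2) \<le> 1" for z
      using FF[of z z] that by (simp add: power2_eq_square)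
    have lo1: "(\<Sum>A\<in>W. (lo z A)\<^sup>2) \<le> 1" if "(\<Sum>k<d. (z k)\<^sup>2) \<le> 1" for z
    proof -
      have "(\<Sum>A\<in>W. (lo z A)\<^sup>2) \<le> (\<Sum>A\<in>W. (F z A)\<^sup>2)"
        by (intro sum_mono) (auto simp: lo_def)
      then show ?thesis using F1[OF that] by linarith
    qed
    \<comment> \<open>The threshold 48 is tuned here: beyond it
      \<open>16 * R\<^sup>2 \<le> R ^ 4 / 3\<close>, and the fourth moment is at most 3, so
      \<open>hi\<close> has norm at most 1/4.\<close>
    have hi1: "(\<Sum>A\<in>W. (4 * hi z A)\<^sup>2) \<le> 1" if "(\<Sum>k<d. (z k)\<^sup>2) \<le> 1" for z
    proof -
      have "(4 * hi z A)\<^sup>2 \<le> R A z ^ 4 / (3 * q\<^sup>2)" for A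
      proof (cases "\<bar>R A z\<bar> \<le> sqrt 48")
        case True
        then show ?thesis by (simp add: hi_def lo_def)
      next
        case False
        then have "(sqrt 48)\<^sup>2 \<le> (R A z)\<^sup>2"
          by (metis abs_le_square_iff abs_of_nonneg linear real_sqrt_ge_zero zero_le_numeral)
        then have "48 * (R A z)\<^sup>2 \<le> (R A z)\<^sup>2 * (R A z)\<^sup>2"
          by (intro mult_right_mono) auto
        then have "16 * (R A z)\<^sup>2 \<le> R A z ^ 4 / 3"
          by (simp add: power4_eq_xxxx power2_eq_square)
        then have "16 * (R A z)\<^sup>2 / q\<^sup>2 \<le> R A z ^ 4 / 3 / q\<^sup>2"
          by (intro divide_right_mono) auto
        then show ?thesis
          using False by (simp add: hi_def lo_def F_def power_mult_distrib power_divide)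
      qed
      then have "(\<Sum>A\<in>W. (4 * hi z A)\<^sup>2) \<le> (\<Sum>A\<in>W. R A z ^ 4 / (3 * q\<^sup>2))"
        by (intro sum_mono)
      also have "\<dots> = (\<Sum>A\<in>W. R A z ^ 4) / (3 * q\<^sup>2)"
        by (simp add: sum_divide_distrib)
      also have "\<dots> \<le> (3 * 2 ^ d * (\<Sum>k<d. (z k)\<^sup>2)\<^sup>2) / (3 * q\<^sup>2)"
        using signed_sum_fourth_moment[of "{..<d}" z]
        by (intro divide_right_mono) (auto simp: R_def W_def)
      also have "\<dots> = (\<Sum>k<d. (z k)\<^sup>2)\<^sup>2"
        by (simp add: q)
      also have "\<dots> \<le> 1"
        using that by (simp add: power_le_one sum_nonneg)
      finally show ?thesis .
    qed
    \<comment> \<open>Expands a product of two sums \<open>lo + hi\<close> as lo lo + hi F + lo hi.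
      Each \<open>hi\<close> is scaled by 4 to norm at most 1, so the last two terms contribute at
      most \<open>S / 4\<close> each.\<close>
    have split: "N i j * (\<Sum>k<d. x i k * y j k) =
        N i j * (\<Sum>A\<in>W. lo (x i) A * lo (y j) A) + N i j * (\<Sum>A\<in>W. (4 * hi (x i) A) * F (y j) A) / 4
        + N i j * (\<Sum>A\<in>W. lo (x i) A * (4 * hi (y j) A)) / 4" for i j
    proof -
      have "(\<Sum>k<d. x i k * y j k) = (\<Sum>A\<in>W. lo (x i) A * lo (y j) A + (4 * hi (x i) A) * F (y j) A / 4
        + lo (x i) A * (4 * hi (y j) A) / 4)"
        unfolding FF[symmetric] by (intro sum.cong refl) (simp add: hi_def field_simps)
      also have "\<dots> = (\<Sum>A\<in>W. lo (x i) A * lo (y j) A) + (\<Sum>A\<in>W. (4 * hi (x i) A) * F (y j) A) / 4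
        + (\<Sum>A\<in>W. lo (x i) A * (4 * hi (y j) A)) / 4"
        by (simp only: sum.distrib sum_divide_distrib)
      finally show ?thesis
        by (simp only: distrib_left times_divide_eq_right)
    qed
    have "v = (\<Sum>i\<in>X. \<Sum>j\<in>Y. N i j * (\<Sum>A\<in>W. lo (x i) A * lo (y j) A))
      + (\<Sum>i\<in>X. \<Sum>j\<in>Y. N i j * (\<Sum>A\<in>W. (4 * hi (x i) A) * F (y j) A)) / 4
      + (\<Sum>i\<in>X. \<Sum>j\<in>Y. N i j * (\<Sum>A\<in>W. lo (x i) A * (4 * hi (y j) A))) / 4"
      unfolding v split by (simp add: sum.distrib sum_divide_distrib)
    moreover have "(\<Sum>i\<in>X. \<Sum>j\<in>Y. N i j * (\<Sum>A\<in>W. (4 * hi (x i) A) * F (y j) A)) \<le> S"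
      by (intro ub fW hi1 F1 x y)
    moreover have "(\<Sum>i\<in>X. \<Sum>j\<in>Y. N i j * (\<Sum>A\<in>W. lo (x i) A * (4 * hi (y j) A))) \<le> S"
      by (intro ub fW hi1 lo1 x y)
    moreover have "(\<Sum>i\<in>X. \<Sum>j\<in>Y. N i j * (\<Sum>A\<in>W. lo (x i) A * lo (y j) A)) \<le> 48 * B"
    proof -
      have "(\<Sum>i\<in>X. \<Sum>j\<in>Y. N i j * (\<Sum>A\<in>W. lo (x i) A * lo (y j) A)) =
        (\<Sum>i\<in>X. \<Sum>A\<in>W. \<Sum>j\<in>Y. N i j * (lo (x i) A * lo (y j) A))"
        by (subst sum.swap) (simp add: sum_distrib_left)
      also have "\<dots> = (\<Sum>A\<in>W. \<Sum>i\<in>X. \<Sum>j\<in>Y. N i j * (lo (x i) A * lo (y j) A))"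
        by (rule sum.swap)
      \<comment> \<open>For a fixed sign pattern the truncated values are scalars bounded by
        \<open>sqrt 48 / q\<close>; the \<open>q\<^sup>2\<close> patterns together leave the factor
        48.\<close>
      also have "\<dots> \<le> (\<Sum>A\<in>W. (sqrt 48 / q)\<^sup>2 * B)"
        by (intro sum_mono bilinear_le_signs B)
          (use q in \<open>auto simp: lo_def F_def divide_right_mono\<close>)
      also have "\<dots> = 48 * B"
        using q by (simp add: W_def card_Pow power_divide)
      finally show ?thesis .
    qed
    ultimately show ?thesis by linarith
  qed
  \<comment> \<open>As the supremum is finite, \<open>S / 2\<close> can be absorbed; this doubles 48
    to 96.\<close>
  have "S \<le> 48 * B + S / 2"
    unfolding S_def
  proof (rule cSup_least)
    have "(\<Sum>i\<in>X. \<Sum>j\<in>Y. N i j * (\<Sum>k<(0::nat). 0 * 0)) \<in> V"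
      unfolding V_def by (intro CollectI exI[of _ 0]) auto
    then show "V \<noteq> {}" by blast
  qed (use improve in \<open>auto simp: S_def\<close>)
  moreover have "(\<Sum>i\<in>X. \<Sum>j\<in>Y. N i j * (\<Sum>k<d. x i k * y j k)) \<in> V"
    unfolding V_def using x y by blast
  then have "(\<Sum>i\<in>X. \<Sum>j\<in>Y. N i j * (\<Sum>k<d. x i k * y j k)) \<le> S"
    unfolding S_def by (rule cSup_upper[OF _ bdd])
  ultimately show ?thesis by linarith
qed

subsection \<open>Low-rank factorizations\<close>

text \<open>Zero vectors are kept, so that the number of vectors remains \<open>r\<close>.\<close>

lemma gram_schmidt_fun:
  fixes b :: "nat \<Rightarrow> 'b \<Rightarrow> real"
  assumes "finite Y"
  shows "\<exists>w. (\<forall>k<r. \<forall>l<r. k \<noteq> l \<longrightarrow> (\<Sum>j\<in>Y. w k j * w l j) = 0) \<and>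
    (\<forall>k<r. (\<Sum>j\<in>Y. w k j * w k j) \<in> {0, 1}) \<and>
    (\<forall>k<r. \<exists>c. \<forall>j\<in>Y. b k j = (\<Sum>l<r. c l * w l j))"
proof (induction r)
  case 0
  show ?case by simp
next
  case (Suc r)
  from Suc obtain w where "\<forall>k<r. \<forall>l<r. k \<noteq> l \<longrightarrow> (\<Sum>j\<in>Y. w k j * w l j) = 0"
    and "\<forall>k<r. (\<Sum>j\<in>Y. w k j * w k j) \<in> {0, 1}"
    and "\<forall>k<r. \<exists>c. \<forall>j\<in>Y. b k j = (\<Sum>l<r. c l * w l j)"
    by (elim exE conjE) (rule that)
  then have orth: "\<And>k l. k < r \<Longrightarrow> l < r \<Longrightarrow> k \<noteq> l \<Longrightarrow> (\<Sum>j\<in>Y. w k j * w l j) = 0"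
    and norm: "\<And>k. k < r \<Longrightarrow> (\<Sum>j\<in>Y. w k j * w k j) \<in> {0, 1}"
    and comb: "\<And>k. k < r \<Longrightarrow> \<exists>c. \<forall>j\<in>Y. b k j = (\<Sum>l<r. c l * w l j)"
    by simp_all
  define e where "e l = (\<Sum>j\<in>Y. b r j * w l j)" for l
  define v where "v j = b r j - (\<Sum>l<r. e l * w l j)" for j
  define t where "t = sqrt (\<Sum>j\<in>Y. v j * v j)"
  \<comment> \<open>If \<open>v\<close> vanishes on \<open>Y\<close>, then \<open>t = 0\<close> and
    division by zero yields the zero vector, whose norm is the value 0 allowed in the claim.\<close>
  define w' where "w' = w(r := (\<lambda>j. v j / t))"
  have v_orth: "(\<Sum>j\<in>Y. v j * w k j) = 0" if k: "k < r" for k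
  proof -
    have "(\<Sum>j\<in>Y. v j * w k j) = e k - (\<Sum>j\<in>Y. \<Sum>l<r. e l * (w l j * w k j))"
      by (simp add: v_def e_def left_diff_distrib sum_subtractf sum_distrib_right mult.assoc)
    also have "(\<Sum>j\<in>Y. \<Sum>l<r. e l * (w l j * w k j)) = (\<Sum>l<r. e l * (\<Sum>j\<in>Y. w l j * w k j))"
      by (subst sum.swap) (simp add: sum_distrib_left)
    also have "\<dots> = (\<Sum>l<r. if l = k then e k * (\<Sum>j\<in>Y. w k j * w k j) else 0)"
      using k orth by (intro sum.cong) auto
    also have "\<dots> = e k * (\<Sum>j\<in>Y. w k j * w k j)"
      using k by simp
    also have "\<dots> = e k"
    proof (cases "(\<Sum>j\<in>Y. w k j * w k j) = 0")
      case True
      then have "\<forall>j\<in>Y. w k j = 0"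
        using assms by (subst (asm) sum_nonneg_eq_0_iff) auto
      then show ?thesis by (simp add: e_def)
    qed (use norm[OF k] in auto)
    finally show ?thesis by simp
  qed
  have t0: "v j = 0" if "t = 0" "j \<in> Y" for j
    using that assms unfolding t_def real_sqrt_eq_0_iff by (subst (asm) sum_nonneg_eq_0_iff) auto
  have tt: "t * t = (\<Sum>j\<in>Y. v j * v j)"
    unfolding t_def by (intro real_sqrt_mult_self[THEN trans] abs_of_nonneg sum_nonneg) auto
  have old: "w' k = w k" if "k < r" for k
    using that by (simp add: w'_def)
  have new: "w' r j = v j / t" for j
    by (simp add: w'_def)
  have new_orth: "(\<Sum>j\<in>Y. w' r j * w' k j) = 0" if "k < r" for k
    using v_orth[OF that] by (simp add: new old[OF that] flip: sum_divide_distrib)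
  have new_orth': "(\<Sum>j\<in>Y. w' k j * w' r j) = 0" if "k < r" for k
    using new_orth[OF that] by (simp add: mult.commute)
  have new_norm: "(\<Sum>j\<in>Y. w' r j * w' r j) \<in> {0, 1}"
    by (cases "t = 0") (simp_all add: new flip: sum_divide_distrib tt)
  have new_comb: "\<forall>j\<in>Y. b r j = (\<Sum>l<Suc r. (e(r := t)) l * w' l j)"
  proof
    fix j assume "j \<in> Y"
    then have "t * w' r j = v j"
      using t0 by (auto simp: new)
    then show "b r j = (\<Sum>l<Suc r. (e(r := t)) l * w' l j)"
      by (simp add: v_def old)
  qed
  show ?case
  proof (intro exI[of _ w'] conjI allI impI)
    fix k l assume "k < Suc r" "l < Suc r" "k \<noteq> l"
    then show "(\<Sum>j\<in>Y. w' k j * w' l j) = 0"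
      using orth old new_orth new_orth' by (auto simp: less_Suc_eq)
  next
    fix k assume "k < Suc r"
    then show "(\<Sum>j\<in>Y. w' k j * w' k j) \<in> {0, 1}"
      by (cases "k = r") (use norm[of k] old[of k] new_norm in simp_all)
  next
    fix k assume "k < Suc r"
    then consider "k < r" | "k = r" by linarith
    then show "\<exists>c. \<forall>j\<in>Y. b k j = (\<Sum>l<Suc r. c l * w' l j)"
    proof cases
      case 1
      then obtain c where "\<forall>j\<in>Y. b k j = (\<Sum>l<r. c l * w l j)"
        using comb by blast
      then show ?thesis
        by (intro exI[of _ "c(r := 0)"]) (simp add: old)
    next
      case 2
      then show ?thesis using new_comb by blast
    qed
  qed
qed

text \<open>Expands the rows in an orthonormal system. By Parseval the coefficient vectors have the
  norms of the rows, and the column vectors have total squared length at most the number of unit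
  vectors; both bounds are independent of the given factors \<open>a\<close> and
  \<open>b\<close>.\<close>

lemma orthogonal_factorization:
  fixes M :: "'a \<Rightarrow> 'b \<Rightarrow> real"
  assumes fin: "finite Y" and M: "\<And>i j. i \<in> X \<Longrightarrow> j \<in> Y \<Longrightarrow> M i j = (\<Sum>k<r. a i k * b k j)"
  obtains u :: "'a \<Rightarrow> nat \<Rightarrow> real" and w :: "nat \<Rightarrow> 'b \<Rightarrow> real"
  where "\<And>i j. i \<in> X \<Longrightarrow> j \<in> Y \<Longrightarrow> M i j = (\<Sum>k<r. u i k * w k j)"
    and "\<And>i. i \<in> X \<Longrightarrow> (\<Sum>k<r. (u i k)\<^sup>2) = (\<Sum>j\<in>Y. (M i j)\<^sup>2)"
    and "(\<Sum>j\<in>Y. \<Sum>k<r. (w k j)\<^sup>2) \<le> real r"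
proof -
  from gram_schmidt_fun[OF fin, of r b] obtain w :: "nat \<Rightarrow> 'b \<Rightarrow> real" where
    "\<forall>k<r. \<forall>l<r. k \<noteq> l \<longrightarrow> (\<Sum>j\<in>Y. w k j * w l j) = 0"
    and "\<forall>k<r. (\<Sum>j\<in>Y. w k j * w k j) \<in> {0, 1}"
    and comb: "\<forall>k<r. \<exists>c. \<forall>j\<in>Y. b k j = (\<Sum>l<r. c l * w l j)"
    by (elim exE conjE) (rule that)
  then have orth: "\<And>k l. k < r \<Longrightarrow> l < r \<Longrightarrow> k \<noteq> l \<Longrightarrow> (\<Sum>j\<in>Y. w k j * w l j) = 0"
    and norm: "\<And>k. k < r \<Longrightarrow> (\<Sum>j\<in>Y. w k j * w k j) \<in> {0, 1}"
    by blast+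
  define c where "c k = (SOME c. \<forall>j\<in>Y. b k j = (\<Sum>l<r. c l * w l j))" for k
  have c: "b k j = (\<Sum>l<r. c k l * w l j)" if "k < r" "j \<in> Y" for k j
    unfolding c_def by (rule bspec[OF someI_ex[OF comb[rule_format, OF that(1)]] that(2)])
  define u where "u i k = (\<Sum>j\<in>Y. M i j * w k j)" for i k
  define d where "d i l = (\<Sum>k<r. a i k * c k l)" for i l
  have Md: "M i j = (\<Sum>l<r. d i l * w l j)" if "i \<in> X" "j \<in> Y" for i j
  proof -
    have "M i j = (\<Sum>k<r. \<Sum>l<r. a i k * c k l * w l j)"
      using M[OF that] c that(2) by (simp add: sum_distrib_left mult.assoc)
    also have "\<dots> = (\<Sum>l<r. d i l * w l j)"
      by (subst sum.swap) (simp add: d_def sum_distrib_right)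
    finally show ?thesis .
  qed
  \<comment> \<open>\<open>u\<close> and \<open>d\<close> can differ only where \<open>w k\<close>
    vanishes on \<open>Y\<close>, and there the coefficient does not affect
    \<open>M\<close>.\<close>
  have ud: "u i k = d i k * (\<Sum>j\<in>Y. w k j * w k j)" if i: "i \<in> X" and k: "k < r" for i k
  proof -
    have "u i k = (\<Sum>j\<in>Y. \<Sum>l<r. d i l * (w l j * w k j))"
      using Md[OF i] by (simp add: u_def sum_distrib_right mult.assoc)
    also have "\<dots> = (\<Sum>l<r. d i l * (\<Sum>j\<in>Y. w l j * w k j))"
      by (subst sum.swap) (simp add: sum_distrib_left)
    also have "\<dots> = (\<Sum>l<r. if l = k then d i k * (\<Sum>j\<in>Y. w k j * w k j) else 0)"
      using k orth by (intro sum.cong) auto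
    finally show ?thesis
      using k by simp
  qed
  have Mu: "M i j = (\<Sum>k<r. u i k * w k j)" if i: "i \<in> X" and j: "j \<in> Y" for i j
  proof -
    have "d i k * w k j = u i k * w k j" if k: "k < r" for k
    proof (cases "(\<Sum>j\<in>Y. w k j * w k j) = 0")
      case True
      then have "\<forall>j\<in>Y. w k j = 0"
        using fin by (subst (asm) sum_nonneg_eq_0_iff) auto
      then show ?thesis using j by simp
    next
      case False
      then show ?thesis using ud[OF i k] norm[OF k] by auto
    qed
    then show ?thesis
      by (subst Md[OF i j]) (auto intro!: sum.cong)
  qed
  show ?thesis
  proof (rule that[OF Mu])
    fix i assume i: "i \<in> X"
    have "(\<Sum>j\<in>Y. (M i j)\<^sup>2) = (\<Sum>j\<in>Y. M i j * (\<Sum>k<r. u i k * w k j))"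
      using Mu[OF i] by (auto simp: power2_eq_square intro!: sum.cong)
    also have "\<dots> = (\<Sum>j\<in>Y. \<Sum>k<r. u i k * (M i j * w k j))"
      by (simp add: sum_distrib_left mult_ac)
    also have "\<dots> = (\<Sum>k<r. (u i k)\<^sup>2)"
      by (subst sum.swap) (simp add: u_def power2_eq_square flip: sum_distrib_left)
    finally show "(\<Sum>k<r. (u i k)\<^sup>2) = (\<Sum>j\<in>Y. (M i j)\<^sup>2)" ..
  next
    have "(\<Sum>j\<in>Y. \<Sum>k<r. (w k j)\<^sup>2) = (\<Sum>k<r. \<Sum>j\<in>Y. w k j * w k j)"
      by (subst sum.swap) (simp add: power2_eq_square)
    also have "\<dots> \<le> (\<Sum>k<r. 1)"
      using norm by (intro sum_mono) force
    finally show "(\<Sum>j\<in>Y. \<Sum>k<r. (w k j)\<^sup>2) \<le> real r" by simp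
  qed
qed

text \<open>At most \<open>r\<close> rows span all of them. The dual form, in terms of annihilated
  vectors \<open>b\<close>, is applied later to columns that vanish on \<open>S\<close>. The
  induction is Gaussian elimination on the last coordinate.\<close>

lemma spanning_rows:
  fixes a :: "'a \<Rightarrow> nat \<Rightarrow> real"
  shows "\<exists>S\<subseteq>X. finite S \<and> card S \<le> r \<and>
    (\<forall>b. (\<forall>i\<in>S. (\<Sum>k<r. a i k * b k) = 0) \<longrightarrow> (\<forall>i\<in>X. (\<Sum>k<r. a i k * b k) = 0))"
proof (induction r arbitrary: a)
  case 0
  show ?case by (intro exI[of _ "{}"]) simp
next
  case (Suc r)
  show ?case
  proof (cases "\<forall>i\<in>X. a i r = 0")
    case True
    obtain S where S: "S \<subseteq> X" "finite S" "card S \<le> r"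
      "\<And>b. (\<forall>i\<in>S. (\<Sum>k<r. a i k * b k) = 0) \<Longrightarrow> (\<forall>i\<in>X. (\<Sum>k<r. a i k * b k) = 0)"
      using Suc.IH by blast
    have *: "(\<Sum>k<Suc r. a i k * b k) = (\<Sum>k<r. a i k * b k)" if "i \<in> X" for i b
      using True that by simp
    show ?thesis
    proof (intro exI[of _ S] conjI allI impI ballI)
      fix b i assume "\<forall>i\<in>S. (\<Sum>k<Suc r. a i k * b k) = 0" "i \<in> X"
      then show "(\<Sum>k<Suc r. a i k * b k) = 0"
        using S(4)[of b] S(1) * by (auto simp: subset_iff simp del: sum.lessThan_Suc)
    qed (use S in auto)
  next
    case False
    then obtain p where p: "p \<in> X" "a p r \<noteq> 0" by blast
    \<comment> \<open>Subtracting a multiple of the pivot row clears coordinate \<open>r\<close>, so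
      the induction hypothesis for \<open>r\<close> coordinates applies.\<close>
    define a' where "a' i k = a i k - a i r / a p r * a p k" for i k
    obtain S where S: "S \<subseteq> X" "finite S" "card S \<le> r"
      "\<And>b. (\<forall>i\<in>S. (\<Sum>k<r. a' i k * b k) = 0) \<Longrightarrow> (\<forall>i\<in>X. (\<Sum>k<r. a' i k * b k) = 0)"
      using Suc.IH[of a'] by blast
    have elim: "(\<Sum>k<r. a' i k * b k) = (\<Sum>k<Suc r. a i k * b k) - a i r / a p r * (\<Sum>k<Suc r. a p k * b k)"
      for i b
    proof -
      have "(\<Sum>k<r. a' i k * b k) = (\<Sum>k<Suc r. a' i k * b k)"
        using p by (simp add: a'_def)
      also have "\<dots> = (\<Sum>k<Suc r. a i k * b k) - a i r / a p r * (\<Sum>k<Suc r. a p k * b k)"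
        by (simp only: a'_def left_diff_distrib sum_subtractf sum_distrib_left mult.assoc)
      finally show ?thesis .
    qed
    show ?thesis
    proof (intro exI[of _ "insert p S"] conjI allI impI)
      show "insert p S \<subseteq> X" "finite (insert p S)" "card (insert p S) \<le> Suc r"
        using S p by (auto simp: card_insert_if)
    next
      fix b assume *: "\<forall>i\<in>insert p S. (\<Sum>k<Suc r. a i k * b k) = 0"
      then have "\<forall>i\<in>S. (\<Sum>k<r. a' i k * b k) = 0"
        unfolding elim by simp
      then have "\<forall>i\<in>X. (\<Sum>k<r. a' i k * b k) = 0"
        by (rule S(4))
      then show "\<forall>i\<in>X. (\<Sum>k<Suc r. a i k * b k) = 0"
        using * unfolding elim by simp
    qed
  qed
qed

text \<open>Markov's inequality, counting the points below the threshold. The case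
  \<open>s = 0\<close> is separate because the argument divides by \<open>s\<close>; there
  \<open>f\<close> vanishes on \<open>X\<close>.\<close>

lemma card_large_values:
  fixes f :: "'a \<Rightarrow> real"
  assumes "finite X" "\<And>i. i \<in> X \<Longrightarrow> f i \<ge> 0" "(\<Sum>i\<in>X. f i) \<le> s" "s \<ge> 0" "q > 0"
  shows "real (card {i\<in>X. f i \<le> q * s / card X}) \<ge> (1 - 1 / q) * card X"
proof (cases "s = 0 \<or> X = {}")
  case True
  then show ?thesis
  proof
    assume "s = 0"
    then have "sum f X = 0"
      using assms by (simp add: order_antisym sum_nonneg)
    then have "\<forall>i\<in>X. f i = 0"
      using assms by (simp add: sum_nonneg_eq_0_iff)
    then have "{i\<in>X. f i \<le> q * s / card X} = X"
      using \<open>s = 0\<close> by auto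
    then show ?thesis
      using assms mult_right_mono[of "1 - 1 / q" 1 "real (card X)"] by simp
  qed simp
next
  case False
  define G where "G = {i\<in>X. f i \<le> q * s / card X}"
  have n: "real (card X) > 0" and s: "s > 0"
    using False assms by (auto simp: card_gt_0_iff)
  have "real (card (X - G)) * (q * s / card X) = (\<Sum>i\<in>X-G. q * s / card X)"
    by simp
  also have "\<dots> \<le> (\<Sum>i\<in>X-G. f i)"
    by (intro sum_mono) (auto simp: G_def)
  also have "\<dots> \<le> (\<Sum>i\<in>X. f i)"
    using assms by (intro sum_mono2) auto
  also have "\<dots> \<le> s" by fact
  finally have "real (card (X - G)) \<le> card X / q"
    using n s \<open>q > 0\<close> by (simp add: field_simps)
  moreover have "real (card (X - G)) = real (card X) - card G"
  proof -
    have "G \<subseteq> X" by (auto simp: G_def)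
    then show ?thesis
      using assms(1) by (simp add: card_Diff_subset finite_subset card_mono of_nat_diff)
  qed
  ultimately show ?thesis
    by (simp add: G_def algebra_simps)
qed

text \<open>A maximal independent set of columns spans all columns and has as many elements as the
  rank; it supplies the left factors.\<close>

lemma real_rank_factorization:
  assumes M: "M \<in> carrier_mat n nc" and rank: "real_rank M \<le> r"
  shows "\<exists>a b. \<forall>i<n. \<forall>j<nc. M $$ (i, j) = (\<Sum>k<r. a i k * b k j)"
proof -
  interpret vec_space "TYPE(real)" n .
  have cols: "set (cols M) \<subseteq> carrier_vec n"
    using cols_dim M by blast
  obtain S where max: "maximal S (\<lambda>T. T \<subseteq> set (cols M) \<and> lin_indpt T)" and finS: "finite S"
    using maximal_exists_superset[of "set (cols M)" "\<lambda>T. T \<subseteq> set (cols M) \<and> lin_indpt T" "{}"]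
      finite_lin_indpt2[of "{}"] by (auto simp: lin_dep_def)
  have S: "S \<subseteq> set (cols M)" "lin_indpt S"
    using max by (auto simp: maximal_def)
  have S_carrier: "S \<subseteq> carrier_vec n"
    using S(1) cols by blast
  have card_S: "card S \<le> r"
    using rank rank_card_indpt[OF M max] M by (simp add: real_rank_def)
  have in_span: "v \<in> span S" if v: "v \<in> set (cols M)" for v
  proof (rule ccontr)
    assume nin: "v \<notin> span S"
    then have "lin_indpt (S \<union> {v})"
      using lin_dep_iff_in_span[OF S_carrier S(2)] v cols S_carrier span_mem by (metis subsetD)
    moreover have "v \<notin> S"
      using nin S_carrier span_mem by blast
    ultimately show False
      using max v S(1) unfolding maximal_def by blast
  qed
  have ex: "\<exists>c. col M j = lincomb c S" if "j < nc" for j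
  proof -
    have col: "col M j \<in> span S"
      using that M by (intro in_span) (auto simp: cols_def)
    obtain c where "lincomb c S = col M j"
      using finite_in_span[OF finS _ col] S_carrier by auto
    then show ?thesis
      by (intro exI[of _ c]) (rule sym)
  qed
  define c where "c j = (SOME c. col M j = lincomb c S)" for j
  have c: "col M j = lincomb (c j) S" if "j < nc" for j
    unfolding c_def by (rule someI_ex[OF ex[OF that]])
  obtain h where h: "bij_betw h {..<card S} S"
    using ex_bij_betw_nat_finite[OF finS] by (auto simp: atLeast0LessThan)
  show ?thesis
  proof (intro exI allI impI)
    fix i j assume ij: "i < n" "j < nc"
    have "M $$ (i, j) = vec_index (col M j) i"
      using M ij by simp
    also have "\<dots> = (\<Sum>v\<in>S. c j v * vec_index v i)"
      using c[OF ij(2)] lincomb_index[OF ij(1) S_carrier] by simp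
    also have "\<dots> = (\<Sum>k<card S. vec_index (h k) i * c j (h k))"
      using sum.reindex_bij_betw[OF h, of "\<lambda>v. c j v * vec_index v i"] by (simp add: mult.commute)
    \<comment> \<open>Padding with zeros extends the sum from the exact rank to \<open>r\<close>
      terms.\<close>
    also have "\<dots> = (\<Sum>k<r. (if k < card S then vec_index (h k) i else 0) * c j (h k))"
      using card_S by (intro sum.mono_neutral_cong_left) auto
    finally show "M $$ (i, j) = (\<Sum>k<r. (if k < card S then vec_index (h k) i else 0) * c j (h k))" .
  qed
qed

subsection \<open>Density decrement\<close>

text \<open>The product of two signs is 1 minus twice the indicators of the two blocks where they
  differ. As \<open>N\<close> has total 0, lower bounds on rectangle sums suffice; hence large
  discrepancy forces a rectangle with too few ones, not merely an unbalanced one.\<close>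

lemma bilinear_signs_le_one_sided:
  fixes N :: "'a \<Rightarrow> 'b \<Rightarrow> real"
  assumes fin: "finite X" "finite Y"
    and zero: "(\<Sum>i\<in>X. \<Sum>j\<in>Y. N i j) = 0"
    and lower: "\<And>X' Y'. X' \<subseteq> X \<Longrightarrow> Y' \<subseteq> Y \<Longrightarrow> (\<Sum>i\<in>X'. \<Sum>j\<in>Y'. N i j) \<ge> - D"
    and s: "\<And>i. s i \<in> {-1, 1}" and t: "\<And>j. t j \<in> {-1, 1}"
  shows "(\<Sum>i\<in>X. \<Sum>j\<in>Y. N i j * (s i * t j)) \<le> 4 * D"
proof -
  define E where "E P Q = (\<Sum>i\<in>X. \<Sum>j\<in>Y. N i j * (of_bool (P i) * of_bool (Q j)))"
    for P :: "'a \<Rightarrow> bool" and Q :: "'b \<Rightarrow> bool"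
  have E: "E P Q \<ge> - D" for P Q
  proof -
    have "E P Q = (\<Sum>i\<in>X. if P i then \<Sum>j\<in>Y. if Q j then N i j else 0 else 0)"
      unfolding E_def by (intro sum.cong) (auto intro!: sum.cong)
    also have "\<dots> = (\<Sum>i\<in>{i\<in>X. P i}. \<Sum>j\<in>{j\<in>Y. Q j}. N i j)"
      using fin by (simp add: sum.inter_filter)
    also have "\<dots> \<ge> - D"
      by (rule lower) auto
    finally show ?thesis .
  qed
  have "N i j * (s i * t j) = N i j
      - 2 * (N i j * (of_bool (s i = 1) * of_bool (t j \<noteq> 1)))
      - 2 * (N i j * (of_bool (s i \<noteq> 1) * of_bool (t j = 1)))" for i j
    using s[of i] t[of j] by auto
  then have "(\<Sum>i\<in>X. \<Sum>j\<in>Y. N i j * (s i * t j)) = (\<Sum>i\<in>X. \<Sum>j\<in>Y. N i j)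
      - 2 * E (\<lambda>i. s i = 1) (\<lambda>j. t j \<noteq> 1) - 2 * E (\<lambda>i. s i \<noteq> 1) (\<lambda>j. t j = 1)"
    unfolding E_def by (simp only: sum_subtractf sum_distrib_left)
  then show ?thesis
    using zero E[of "\<lambda>i. s i = 1" "\<lambda>j. t j \<noteq> 1"] E[of "\<lambda>i. s i \<noteq> 1" "\<lambda>j. t j = 1"]
    by linarith
qed

text \<open>If every deficit were below \<open>D\<close>, Grothendieck's inequality would bound the
  vector form by \<open>384 * D\<close>. The normalized factorization vectors reach
  \<open>sqrt (p / r) / 16\<close> times the area, and 384 / 10000 < 1 / 16.\<close>

lemma density_decrement:
  fixes M :: "'a \<Rightarrow> 'b \<Rightarrow> real" and p :: real
  assumes fin: "finite X" "finite Y" and ne: "X \<noteq> {}" "Y \<noteq> {}"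
    and M01: "\<And>i j. i \<in> X \<Longrightarrow> j \<in> Y \<Longrightarrow> M i j \<in> {0, 1}"
    and fact: "\<And>i j. i \<in> X \<Longrightarrow> j \<in> Y \<Longrightarrow> M i j = (\<Sum>k<r. a i k * b k j)"
    and p: "(\<Sum>i\<in>X. \<Sum>j\<in>Y. M i j) = p * card X * card Y"
    and p_le: "p \<le> 1 / 2" and p_ge: "1 \<le> 4 * real r * p"
  shows "\<exists>X'\<subseteq>X. \<exists>Y'\<subseteq>Y. (\<Sum>i\<in>X'. \<Sum>j\<in>Y'. M i j)
    \<le> p * card X' * card Y' - sqrt (p / r) / 10000 * card X * card Y"
proof (rule ccontr)
  define m n where "m = real (card X)" and "n = real (card Y)"
  define D where "D = sqrt (p / r) / 10000 * m * n"
  assume *: "\<not> ?thesis"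
  have dense: "(\<Sum>i\<in>X'. \<Sum>j\<in>Y'. M i j) > p * card X' * card Y' - D" if "X' \<subseteq> X" "Y' \<subseteq> Y" for X' Y'
  proof (rule ccontr)
    assume "\<not> ?thesis"
    then have "(\<Sum>i\<in>X'. \<Sum>j\<in>Y'. M i j)
        \<le> p * card X' * card Y' - sqrt (p / r) / 10000 * card X * card Y"
      by (simp only: D_def m_def n_def not_less)
    with that * show False by blast
  qed
  have mn: "m > 0" "n > 0"
    using fin ne by (auto simp: m_def n_def card_gt_0_iff)
  have p0: "p > 0"
    using p_ge mult_nonneg_nonpos[of "4 * real r" p] by linarith
  have r0: "real r > 0"
    using p_ge by (cases r) auto
  have M0: "M i j \<ge> 0" "(M i j)\<^sup>2 = M i j" if "i \<in> X" "j \<in> Y" for i j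
    using M01[OF that] by auto
  \<comment> \<open>By \<open>p_ge\<close>, the deficit \<open>D\<close> is small compared with the
    number \<open>p * m * n\<close> of ones.\<close>
  have sqrt_pr: "sqrt (p / r) \<le> 2 * p"
  proof -
    have "p / r \<le> (2 * p)\<^sup>2"
      using p0 r0 p_ge by (simp add: field_simps power2_eq_square)
    then show ?thesis
      using p0 by (intro real_le_lsqrt) auto
  qed

  obtain u w where uw: "\<And>i j. i \<in> X \<Longrightarrow> j \<in> Y \<Longrightarrow> M i j = (\<Sum>k<r. u i k * w k j)"
    and u: "\<And>i. i \<in> X \<Longrightarrow> (\<Sum>k<r. (u i k)\<^sup>2) = (\<Sum>j\<in>Y. (M i j)\<^sup>2)"
    and w: "(\<Sum>j\<in>Y. \<Sum>k<r. (w k j)\<^sup>2) \<le> real r"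
  proof (rule orthogonal_factorization[where M = M and X = X and Y = Y and r = r and a = a and b = b])
    show "finite Y" by (rule fin)
    show "M i j = (\<Sum>k<r. a i k * b k j)" if "i \<in> X" "j \<in> Y" for i j
      using that by (rule fact)
  qed (rule that; simp)
  \<comment> \<open>Three quarters of the rows and of the columns survive, hence 9/16 of the area;
    since \<open>D\<close> is small, the remaining rectangle still holds at least half of the
    ones.\<close>
  define X1 where "X1 = {i\<in>X. (\<Sum>j\<in>Y. M i j) \<le> 4 * (p * m * n) / card X}"
  define Y1 where "Y1 = {j\<in>Y. (\<Sum>k<r. (w k j)\<^sup>2) \<le> 4 * real r / card Y}"
  have X1: "X1 \<subseteq> X" "real (card X1) \<ge> (1 - 1 / 4) * m"
    using card_large_values[of X "\<lambda>i. \<Sum>j\<in>Y. M i j" "p * m * n" 4] fin p p0 mn M0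
    by (auto simp: X1_def m_def n_def sum_nonneg)
  have Y1: "Y1 \<subseteq> Y" "real (card Y1) \<ge> (1 - 1 / 4) * n"
    using card_large_values[of Y "\<lambda>j. \<Sum>k<r. (w k j)\<^sup>2" "real r" 4] fin w
    by (auto simp: Y1_def n_def sum_nonneg)
  \<comment> \<open>Length bounds for the retained row and column vectors. The side \<open>n\<close>
    cancels in the product: \<open>A * B = 4 * sqrt (p * r)\<close>.\<close>
  define A B where "A = sqrt (4 * (p * n))" and "B = sqrt (4 * real r / n)"
  have AB0: "A > 0" "B > 0" and A2: "A\<^sup>2 = 4 * (p * n)" and B2: "B\<^sup>2 = 4 * real r / n"
    using p0 mn r0 by (auto simp: A_def B_def)
  have AB: "p / (A * B) = sqrt (p / r) / 4"
  proof (rule power2_eq_imp_eq)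
    show "(p / (A * B))\<^sup>2 = (sqrt (p / r) / 4)\<^sup>2"
      using p0 mn r0 by (simp add: power_divide power_mult_distrib A2 B2) (simp add: field_simps power2_eq_square)
  qed (use AB0 p0 r0 in auto)
  define x where "x i k = (if i \<in> X1 then u i k / A else 0)" for i k
  define y where "y j k = (if j \<in> Y1 then w k j / B else 0)" for j k
  have x: "(\<Sum>k<r. (x i k)\<^sup>2) \<le> 1" for i
  proof (cases "i \<in> X1")
    case True
    then have i: "i \<in> X" using X1 by blast
    have "(\<Sum>k<r. (x i k)\<^sup>2) = (\<Sum>j\<in>Y. M i j) / A\<^sup>2"
      using True u[OF i] M0(2)[OF i] by (simp add: x_def power_divide flip: sum_divide_distrib)
    also have "\<dots> \<le> 1"
      using True mn p0 by (simp add: A2 X1_def m_def mult.assoc)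
    finally show ?thesis .
  qed (simp add: x_def)
  have y: "(\<Sum>k<r. (y j k)\<^sup>2) \<le> 1" for j
  proof (cases "j \<in> Y1")
    case True
    then have "(\<Sum>k<r. (y j k)\<^sup>2) = (\<Sum>k<r. (w k j)\<^sup>2) / B\<^sup>2"
      by (simp add: y_def power_divide flip: sum_divide_distrib)
    also have "\<dots> \<le> 1"
      using True mn r0 by (auto simp: B2 Y1_def n_def field_simps)
    finally show ?thesis .
  qed (simp add: y_def)
  define N where "N i j = M i j - p" for i j
  have sumN: "(\<Sum>i\<in>X'. \<Sum>j\<in>Y'. N i j) = (\<Sum>i\<in>X'. \<Sum>j\<in>Y'. M i j) - p * card X' * card Y'" for X' Y'
    by (simp add: N_def sum_subtractf)
  have upper: "(\<Sum>i\<in>X. \<Sum>j\<in>Y. N i j * (\<Sum>k<r. x i k * y j k)) \<le> 96 * (4 * D)"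
  proof (rule grothendieck_inequality[OF _ x y])
    fix s :: "'a \<Rightarrow> real" and t :: "'b \<Rightarrow> real"
    assume st: "\<And>i. s i \<in> {-1, 1}" "\<And>j. t j \<in> {-1, 1}"
    show "(\<Sum>i\<in>X. \<Sum>j\<in>Y. N i j * (s i * t j)) \<le> 4 * D"
    proof (rule bilinear_signs_le_one_sided[OF fin _ _ st])
      show "(\<Sum>i\<in>X. \<Sum>j\<in>Y. N i j) = 0"
        by (simp add: sumN p)
      show "- D \<le> (\<Sum>i\<in>X'. \<Sum>j\<in>Y'. N i j)" if "X' \<subseteq> X" "Y' \<subseteq> Y" for X' Y'
        using dense[OF that] by (simp add: sumN)
    qed
  qed
  have "(\<Sum>i\<in>X. \<Sum>j\<in>Y. N i j * (\<Sum>k<r. x i k * y j k)) =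
      (\<Sum>i\<in>X. if i \<in> X1 then \<Sum>j\<in>Y. if j \<in> Y1 then (1 - p) / (A * B) * M i j else 0 else 0)"
  proof (intro sum.cong refl)
    fix i assume i: "i \<in> X"
    \<comment> \<open>For 0/1 entries \<open>(M i j - p) * M i j = (1 - p) * M i j\<close>, so each
      retained one counts with weight at least 1/2 and zeros count nothing.\<close>
    have "N i j * (\<Sum>k<r. x i k * y j k) = (1 - p) / (A * B) * M i j"
      if "i \<in> X1" "j \<in> Y1" for j
    proof -
      have j: "j \<in> Y" using Y1 that by blast
      have "(\<Sum>k<r. x i k * y j k) = M i j / (A * B)"
        using that uw[OF i j] by (simp add: x_def y_def flip: sum_divide_distrib)
      then show ?thesis
        using M01[OF i j] by (auto simp: N_def)
    qed
    moreover have "(\<Sum>k<r. x i k * y j k) = 0" if "\<not> (i \<in> X1 \<and> j \<in> Y1)" for j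
      using that by (auto simp: x_def y_def)
    ultimately show "(\<Sum>j\<in>Y. N i j * (\<Sum>k<r. x i k * y j k)) =
      (if i \<in> X1 then \<Sum>j\<in>Y. if j \<in> Y1 then (1 - p) / (A * B) * M i j else 0 else 0)"
      by (auto intro!: sum.cong sum.neutral)
  qed
  also have "\<dots> = (\<Sum>i\<in>{i\<in>X. i \<in> X1}. \<Sum>j\<in>{j\<in>Y. j \<in> Y1}. (1 - p) / (A * B) * M i j)"
    using fin by (simp only: sum.inter_filter)
  also have "{i\<in>X. i \<in> X1} = X1"
    using X1 by auto
  also have "{j\<in>Y. j \<in> Y1} = Y1"
    using Y1 by auto
  also have "(\<Sum>i\<in>X1. \<Sum>j\<in>Y1. (1 - p) / (A * B) * M i j) = (1 - p) / (A * B) * (\<Sum>i\<in>X1. \<Sum>j\<in>Y1. M i j)"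
    by (simp only: sum_distrib_left)
  also have "\<dots> \<ge> (1 / 2) / (A * B) * (p * m * n / 2)"
  proof (intro mult_mono divide_right_mono)
    have "(3 / 4 * m) * (3 / 4 * n) \<le> real (card X1) * real (card Y1)"
      using X1 Y1 mn by (intro mult_mono) auto
    then have "p * ((3 / 4 * m) * (3 / 4 * n)) \<le> p * (real (card X1) * real (card Y1))"
      using p0 by (intro mult_left_mono) auto
    moreover have "D \<le> 2 * p / 10000 * m * n"
      unfolding D_def using sqrt_pr mn by (intro mult_right_mono divide_right_mono) auto
    moreover have "p * m * n > 0"
      using p0 mn by simp
    ultimately show "p * m * n / 2 \<le> (\<Sum>i\<in>X1. \<Sum>j\<in>Y1. M i j)"
      using dense[OF X1(1) Y1(1)] by (simp add: mult_ac)
  qed (use p_le p0 mn AB0 in auto)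
  also have "(1 / 2) / (A * B) * (p * m * n / 2) = sqrt (p / r) / 16 * m * n"
  proof -
    have "(1 / 2) / (A * B) * (p * m * n / 2) = p / (A * B) * (m * n / 4)"
      by simp
    then show ?thesis unfolding AB by simp
  qed
  finally have "sqrt (p / r) / 16 * m * n \<le> 96 * (4 * D)"
    using upper by linarith
  moreover have "sqrt (p / r) * m * n > 0"
    using p0 r0 mn by simp
  ultimately show False
    by (simp add: D_def mult_ac)
qed

section \<open>Iteration of the decrement\<close>

text \<open>Here \<open>t\<close> is the fraction of the area kept. For the two square roots
  \<open>u\<close> and \<open>v\<close>, \<open>u / (10000 * t) \<le> u\<^sup>2 - v\<^sup>2 \<le> 2
  * u * (u - v)\<close>, so \<open>20000 * (u - v)\<close> is at least \<open>1 / t\<close>, and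
  \<open>exp (1 / t) \<ge> 1 / t\<close>.\<close>

lemma exp_potential_step:
  fixes p q r t :: real
  assumes p: "p > 0" and r: "r > 0" and t: "t > 0" and q: "q \<ge> 0"
    and le: "q \<le> p - sqrt (p / r) / 10000 / t"
  shows "exp (- 20000 * sqrt (r * p)) \<le> t * exp (- 20000 * sqrt (r * q))"
proof -
  define u v where "u = sqrt (r * p)" and "v = sqrt (r * q)"
  have u: "u > 0" "u\<^sup>2 = r * p" and v: "v \<ge> 0" "v\<^sup>2 = r * q"
    using p q r by (auto simp: u_def v_def)
  have "sqrt (p / r) = u / r"
    using r by (simp add: u_def real_sqrt_divide real_sqrt_mult field_simps)
  then have "r * q \<le> r * (p - u / r / 10000 / t)"
    using le r by (intro mult_left_mono) auto
  then have uv: "u / (10000 * t) \<le> u\<^sup>2 - v\<^sup>2"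
    using r by (simp add: u v right_diff_distrib)
  moreover have "u / (10000 * t) > 0"
    using u t by simp
  ultimately have "v < u"
    using u v by (intro power2_less_imp_less[of v u]) auto
  have "u\<^sup>2 - v\<^sup>2 = (u - v) * (u + v)"
    by (simp add: power2_eq_square algebra_simps)
  also have "\<dots> \<le> (u - v) * (2 * u)"
    using \<open>v < u\<close> by (intro mult_left_mono) auto
  finally have "u * (1 / (10000 * t)) \<le> u * (2 * (u - v))"
    using uv by (simp add: mult_ac)
  then have "1 / (10000 * t) \<le> 2 * (u - v)"
    using u by (simp only: mult_le_cancel_left_pos)
  then have "1 / t \<le> 20000 * (u - v)"
    by simp
  moreover have "1 / t \<le> exp (1 / t)"
    using exp_ge_add_one_self[of "1 / t"] by linarith
  ultimately have "1 / t \<le> exp (20000 * (u - v))"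
    by (meson exp_le_cancel_iff order_trans)
  then have "1 / t * (t * exp (- 20000 * u)) \<le> exp (20000 * (u - v)) * (t * exp (- 20000 * u))"
    using t by (intro mult_right_mono) auto
  also have "exp (20000 * (u - v)) * (t * exp (- 20000 * u)) = t * exp (- 20000 * v)"
    by (simp add: mult.left_commute algebra_simps flip: exp_add)
  finally show ?thesis
    using t by (simp add: u_def v_def)
qed

text \<open>Induction on the number of rows plus columns, since a decrement always selects a proper
  subrectangle. The loss factor depends on the current density, so that the losses of successive
  steps telescope.\<close>

lemma sparse_subrectangle:
  fixes M :: "'a \<Rightarrow> 'b \<Rightarrow> real" and p :: real
  assumes "finite X" "finite Y" "X \<noteq> {}" "Y \<noteq> {}"
    and "\<And>i j. i \<in> X \<Longrightarrow> j \<in> Y \<Longrightarrow> M i j \<in> {0, 1}"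
    and "\<And>i j. i \<in> X \<Longrightarrow> j \<in> Y \<Longrightarrow> M i j = (\<Sum>k<r. a i k * b k j)"
    and "(\<Sum>i\<in>X. \<Sum>j\<in>Y. M i j) = p * card X * card Y" and "p \<le> 1 / 2" and "r > 0"
  shows "\<exists>X'\<subseteq>X. \<exists>Y'\<subseteq>Y. X' \<noteq> {} \<and> Y' \<noteq> {} \<and>
    4 * real r * (\<Sum>i\<in>X'. \<Sum>j\<in>Y'. M i j) \<le> real (card X') * real (card Y') \<and>
    card X * exp (- 20000 * sqrt (r * p)) \<le> card X' \<and> card Y * exp (- 20000 * sqrt (r * p)) \<le> card Y'"
  using assms
proof (induction "card X + card Y" arbitrary: X Y p rule: less_induct)
  case less
  note fin = less.prems(1,2) and ne = less.prems(3,4) and M01 = less.prems(5) and fact = less.prems(6)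
    and p = less.prems(7) and p_le = less.prems(8) and r = less.prems(9)
  define m n where "m = real (card X)" and "n = real (card Y)"
  have mn: "m > 0" "n > 0"
    using fin ne by (auto simp: m_def n_def card_gt_0_iff)
  have e0: "(\<Sum>i\<in>X'. \<Sum>j\<in>Y'. M i j) \<ge> 0" if sub: "X' \<subseteq> X" "Y' \<subseteq> Y" for X' Y'
  proof (intro sum_nonneg)
    show "M i j \<ge> 0" if "i \<in> X'" "j \<in> Y'" for i j
      using M01[OF subsetD[OF sub(1) that(1)] subsetD[OF sub(2) that(2)]] by auto
  qed
  have "p * (m * n) \<ge> 0"
    using e0[of X Y] p by (simp add: m_def n_def mult.assoc)
  then have p0: "p \<ge> 0"
    using mult_pos_pos[OF mn] by (auto simp: zero_le_mult_iff)
  show ?case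
  proof (cases "4 * real r * p \<le> 1")
    case True
    have "4 * real r * p * (m * n) \<le> 1 * (m * n)"
      using True mn by (intro mult_right_mono) auto
    then have "4 * real r * (\<Sum>i\<in>X. \<Sum>j\<in>Y. M i j) \<le> real (card X) * real (card Y)"
      unfolding p by (simp add: m_def n_def mult_ac)
    moreover have "k * exp (- 20000 * sqrt (r * p)) \<le> k" if "k \<ge> 0" for k :: real
      using that p0 by (intro mult_right_le_one_le) auto
    ultimately show ?thesis
      using ne by (intro exI[of _ X] exI[of _ Y] conjI) auto
  next
    case False
    then have p_pos: "p > 0"
      using p0 by (cases "p = 0") auto
    define \<delta> where "\<delta> = sqrt (p / r) / 10000"
    have \<delta>: "\<delta> > 0"
      using p_pos r by (simp add: \<delta>_def)
    have "\<exists>X'\<subseteq>X. \<exists>Y'\<subseteq>Y. (\<Sum>i\<in>X'. \<Sum>j\<in>Y'. M i j)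
      \<le> p * card X' * card Y' - sqrt (p / r) / 10000 * card X * card Y"
    proof (rule density_decrement[OF fin ne])
      show "M i j \<in> {0, 1}" if "i \<in> X" "j \<in> Y" for i j
        using that by (rule M01)
      show "M i j = (\<Sum>k<r. a i k * b k j)" if "i \<in> X" "j \<in> Y" for i j
        using that by (rule fact)
      show "1 \<le> 4 * real r * p" using False by simp
    qed (rule p p_le)+
    then obtain X1 Y1 where sub: "X1 \<subseteq> X" "Y1 \<subseteq> Y"
      and "(\<Sum>i\<in>X1. \<Sum>j\<in>Y1. M i j) \<le> p * card X1 * card Y1 - sqrt (p / r) / 10000 * card X * card Y"
      by (elim exE conjE) (rule that)
    then have decr: "(\<Sum>i\<in>X1. \<Sum>j\<in>Y1. M i j) \<le> p * card X1 * card Y1 - \<delta> * (m * n)"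
      by (simp add: \<delta>_def m_def n_def)
    have pos: "\<delta> * (m * n) > 0"
      using \<delta> mn by simp
    \<comment> \<open>With an empty side, \<open>decr\<close> would read
      \<open>0 \<le> - \<delta> * (m * n)\<close>.\<close>
    have ne1: "X1 \<noteq> {}" "Y1 \<noteq> {}"
      using decr pos by auto
    have fin1: "finite X1" "finite Y1"
      using sub fin by (auto intro: finite_subset)
    define m1 n1 where "m1 = real (card X1)" and "n1 = real (card Y1)"
    have mn1: "m1 > 0" "n1 > 0"
      using fin1 ne1 by (auto simp: m1_def n1_def card_gt_0_iff)
    have le: "m1 \<le> m" "n1 \<le> n"
      using sub fin by (auto simp: m1_def n1_def m_def n_def card_mono)
    have smaller: "card X1 + card Y1 < card X + card Y"
    proof (rule ccontr)
      assume "\<not> ?thesis"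
      then have "card X1 = card X" "card Y1 = card Y"
        using le by (auto simp: m1_def n1_def m_def n_def)
      then have "X1 = X" "Y1 = Y"
        using sub fin by (auto simp: card_subset_eq)
      then show False
        using decr p pos by simp
    qed
    define q where "q = (\<Sum>i\<in>X1. \<Sum>j\<in>Y1. M i j) / (m1 * n1)"
    have q: "(\<Sum>i\<in>X1. \<Sum>j\<in>Y1. M i j) = q * card X1 * card Y1"
      using mn1 by (simp add: q_def m1_def n1_def)
    have q0: "q \<ge> 0"
      using e0[OF sub] mn1 by (simp add: q_def)
    define t where "t = m1 * n1 / (m * n)"
    have t: "t > 0" using mn mn1 by (simp add: t_def)
    have "q \<le> (p * m1 * n1 - \<delta> * (m * n)) / (m1 * n1)"
      unfolding q_def using decr mn1 by (intro divide_right_mono) (auto simp: m1_def n1_def)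
    also have "\<dots> = p - \<delta> / t"
      using mn mn1 by (simp add: t_def field_simps)
    finally have qt: "q \<le> p - sqrt (p / r) / 10000 / t"
      by (simp add: \<delta>_def)
    have "\<delta> / t \<ge> 0" using \<delta> t by simp
    then have q_le: "q \<le> 1 / 2"
      using qt p_le by (simp add: \<delta>_def)
    have pot: "exp (- 20000 * sqrt (r * p)) \<le> t * exp (- 20000 * sqrt (r * q))"
      using p_pos r t q0 qt by (intro exp_potential_step) auto
    have "\<exists>X'\<subseteq>X1. \<exists>Y'\<subseteq>Y1. X' \<noteq> {} \<and> Y' \<noteq> {} \<and>
      4 * real r * (\<Sum>i\<in>X'. \<Sum>j\<in>Y'. M i j) \<le> real (card X') * real (card Y') \<and>
      card X1 * exp (- 20000 * sqrt (r * q)) \<le> card X' \<and> card Y1 * exp (- 20000 * sqrt (r * q)) \<le> card Y'"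
    proof (rule less.hyps[OF smaller fin1 ne1])
      show "M i j \<in> {0, 1}" if "i \<in> X1" "j \<in> Y1" for i j
        using that sub by (intro M01) auto
      show "M i j = (\<Sum>k<r. a i k * b k j)" if "i \<in> X1" "j \<in> Y1" for i j
        using that sub by (intro fact) auto
    qed (rule q q_le r)+
    then obtain X' Y' where XY: "X' \<subseteq> X1" "Y' \<subseteq> Y1" "X' \<noteq> {}" "Y' \<noteq> {}"
      "4 * real r * (\<Sum>i\<in>X'. \<Sum>j\<in>Y'. M i j) \<le> real (card X') * real (card Y')"
      "m1 * exp (- 20000 * sqrt (r * q)) \<le> card X'" "n1 * exp (- 20000 * sqrt (r * q)) \<le> card Y'"
      unfolding m1_def[symmetric] n1_def[symmetric] by (elim exE conjE) (rule that)
    \<comment> \<open>The area fraction is the product of two side ratios, each at most 1. Each side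
      therefore keeps at least the fraction \<open>t\<close>, and one potential bound serves
      both.\<close>
    have "t \<le> m1 / m"
      using mult_mono[of m1 m1 n1 n] mn mn1 le by (simp add: t_def field_simps)
    then have "m * t \<le> m1"
      using mn by (simp add: field_simps)
    have "t \<le> n1 / n"
      using mult_mono[of m1 m n1 n1] mn mn1 le by (simp add: t_def field_simps)
    then have "n * t \<le> n1"
      using mn by (simp add: field_simps)
    have "m * exp (- 20000 * sqrt (r * p)) \<le> m * (t * exp (- 20000 * sqrt (r * q)))"
      using pot mn by (intro mult_left_mono) auto
    also have "\<dots> \<le> m1 * exp (- 20000 * sqrt (r * q))"
      unfolding mult.assoc[symmetric] using \<open>m * t \<le> m1\<close> by (intro mult_right_mono) auto
    also note XY(6)
    finally have cX: "card X * exp (- 20000 * sqrt (r * p)) \<le> card X'"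
      unfolding m_def .
    have "n * exp (- 20000 * sqrt (r * p)) \<le> n * (t * exp (- 20000 * sqrt (r * q)))"
      using pot mn by (intro mult_left_mono) auto
    also have "\<dots> \<le> n1 * exp (- 20000 * sqrt (r * q))"
      unfolding mult.assoc[symmetric] using \<open>n * t \<le> n1\<close> by (intro mult_right_mono) auto
    also note XY(7)
    finally have cY: "card Y * exp (- 20000 * sqrt (r * p)) \<le> card Y'"
      unfolding n_def .
    show ?thesis
      using XY(1-5) sub cX cY by (intro exI[of _ X'] exI[of _ Y'] conjI) auto
  qed
qed

section \<open>Zero rectangles in sparse matrices\<close>

text \<open>On the light rows \<open>X1\<close> the matrix is determined by at most \<open>r\<close>
  of them, so a column that vanishes on these vanishes on all of \<open>X1\<close>.\<close>

lemma sparse_zero_rectangle: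
  fixes M :: "'a \<Rightarrow> 'b \<Rightarrow> real"
  assumes fin: "finite X" "finite Y" and ne: "X \<noteq> {}"
    and M01: "\<And>i j. i \<in> X \<Longrightarrow> j \<in> Y \<Longrightarrow> M i j \<in> {0, 1}"
    and fact: "\<And>i j. i \<in> X \<Longrightarrow> j \<in> Y \<Longrightarrow> M i j = (\<Sum>k<r. a i k * b k j)"
    and sparse: "4 * real r * (\<Sum>i\<in>X. \<Sum>j\<in>Y. M i j) \<le> real (card X) * real (card Y)" and r: "r > 0"
  shows "\<exists>X'\<subseteq>X. \<exists>Y'\<subseteq>Y. (\<forall>i\<in>X'. \<forall>j\<in>Y'. M i j = 0) \<and>
    real (card X) \<le> 2 * real (card X') \<and> real (card Y) \<le> 2 * real (card Y')"
proof -
  define e where "e = (\<Sum>i\<in>X. \<Sum>j\<in>Y. M i j)"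
  have M0: "M i j \<ge> 0" if "i \<in> X" "j \<in> Y" for i j
    using M01[OF that] by auto
  have m: "real (card X) > 0"
    using fin ne by (auto simp: card_gt_0_iff)
  define X1 where "X1 = {i\<in>X. (\<Sum>j\<in>Y. M i j) \<le> 2 * e / card X}"
  have X1: "X1 \<subseteq> X" by (auto simp: X1_def)
  have "real (card X1) \<ge> (1 - 1 / 2) * card X"
    unfolding X1_def using fin M0 by (intro card_large_values) (auto simp: e_def sum_nonneg)
  then have cX: "real (card X) \<le> 2 * real (card X1)" by simp
  obtain S where S: "S \<subseteq> X1" "finite S" "card S \<le> r"
    "\<forall>b. (\<forall>i\<in>S. (\<Sum>k<r. a i k * b k) = 0) \<longrightarrow> (\<forall>i\<in>X1. (\<Sum>k<r. a i k * b k) = 0)"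
    using spanning_rows[of X1 r a] by (elim exE conjE) (rule that)
  define Y1 where "Y1 = {j\<in>Y. \<forall>i\<in>S. M i j = 0}"
  have zero: "M i j = 0" if i: "i \<in> X1" and j: "j \<in> Y1" for i j
  proof -
    have jY: "j \<in> Y" using j by (simp add: Y1_def)
    have "(\<Sum>k<r. a i k * b k j) = 0" if "i \<in> S" for i
    proof -
      have "i \<in> X" using that S(1) X1 by blast
      then show ?thesis using fact[OF _ jY, of i] j that by (simp add: Y1_def)
    qed
    then have "(\<Sum>k<r. a i k * b k j) = 0"
      using S(4)[rule_format, of "\<lambda>k. b k j" i] i by blast
    then show ?thesis
      using fact[of i j] i jY X1 by auto
  qed
  \<comment> \<open>Each lost column has a one in some row of \<open>S\<close>. At most
    \<open>r\<close> rows with at most \<open>2 * e / card X\<close> ones each account for at most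
    half of the columns; this fixes the factor \<open>4 * r\<close> in
    \<open>sparse\<close>.\<close>
  have "real (card (Y - Y1)) = (\<Sum>j\<in>Y-Y1. 1)" by simp
  also have "\<dots> \<le> (\<Sum>j\<in>Y-Y1. \<Sum>i\<in>S. M i j)"
  proof (rule sum_mono)
    fix j assume j: "j \<in> Y - Y1"
    then obtain i where i: "i \<in> S" "M i j \<noteq> 0"
      by (auto simp: Y1_def)
    then have "M i j = 1"
      using M01[of i j] S(1) X1 j by auto
    moreover have "M i j \<le> (\<Sum>i\<in>S. M i j)"
      using i S X1 j by (intro member_le_sum) (auto intro!: M0)
    ultimately show "1 \<le> (\<Sum>i\<in>S. M i j)" by simp
  qed
  also have "\<dots> \<le> (\<Sum>j\<in>Y. \<Sum>i\<in>S. M i j)"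
    using fin S X1 by (intro sum_mono2) (auto intro!: sum_nonneg M0)
  also have "\<dots> = (\<Sum>i\<in>S. \<Sum>j\<in>Y. M i j)"
    by (rule sum.swap)
  also have "\<dots> \<le> (\<Sum>i\<in>S. 2 * e / card X)"
    using S(1) by (intro sum_mono) (auto simp: X1_def)
  also have "\<dots> = real (card S) * (2 * e / card X)" by simp
  also have "\<dots> \<le> real r * (2 * e / card X)"
    using S(3) M0 by (intro mult_right_mono) (auto simp: e_def sum_nonneg)
  also have "\<dots> \<le> real (card Y) / 2"
    using sparse m by (simp add: e_def field_simps)
  finally have "real (card (Y - Y1)) \<le> real (card Y) / 2" .
  moreover have "real (card (Y - Y1)) = real (card Y) - real (card Y1)"
  proof -
    have "Y1 \<subseteq> Y" by (auto simp: Y1_def)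
    then show ?thesis
      using fin by (simp add: card_Diff_subset finite_subset card_mono of_nat_diff)
  qed
  ultimately have "real (card Y) \<le> 2 * real (card Y1)" by linarith
  moreover have "Y1 \<subseteq> Y" by (auto simp: Y1_def)
  ultimately show ?thesis
    using X1 cX zero by (intro exI[of _ X1] exI[of _ Y1] conjI) auto
qed

subsection \<open>Square zero submatrices\<close>

lemma zarank_ge:
  assumes "zero_rect M X Y" "k \<le> card X" "k \<le> card Y"
  shows "k \<le> zarank M"
proof -
  obtain X' Y' where XY: "X' \<subseteq> X" "card X' = k" "Y' \<subseteq> Y" "card Y' = k"
    using assms(2,3) by (meson obtain_subset_with_card_n)
  have "zero_rect M X' Y'"
    using assms(1) XY unfolding zero_rect_def by blast
  then have "k \<in> {z. \<exists>X Y. zero_rect M X Y \<and> card X = z \<and> card Y = z}"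
    using XY by blast
  \<comment> \<open>The set of sizes is finite, so its \<open>Max\<close> is a genuine
    maximum.\<close>
  moreover have "{z. \<exists>X Y. zero_rect M X Y \<and> card X = z \<and> card Y = z} \<subseteq> {..dim_row M}"
  proof
    fix z assume "z \<in> {z. \<exists>X Y. zero_rect M X Y \<and> card X = z \<and> card Y = z}"
    then obtain X where "X \<subseteq> {..<dim_row M}" "card X = z"
      by (auto simp: zero_rect_def)
    then show "z \<in> {..dim_row M}"
      using card_mono[of "{..<dim_row M}" X] by simp
  qed
  ultimately show ?thesis
    unfolding zarank_def by (intro Max_ge) (auto intro: finite_subset)
qed

text \<open>The exponential is the loss of the iteration; the factor 2 is the halving of both sides
  when the sparse rectangle is cut down to a zero one.\<close>

lemma zarank_lower_bound:
  fixes M :: "real mat"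
  assumes r: "r > 0" and M: "M \<in> carrier_mat n n" and M01: "zero_one_mat M"
    and rank: "real_rank M \<le> r" and density: "density M \<le> 1 / 2" and n: "n > 0"
  shows "real n * exp (- 20000 * sqrt r) \<le> 2 * real (zarank M)"
proof -
  define A where "A i j = M $$ (i, j)" for i j
  have A01: "A i j \<in> {0, 1}" if "i \<in> {..<n}" "j \<in> {..<n}" for i j
    using M01 M that by (auto simp: zero_one_mat_def A_def)
  obtain a b where "\<forall>i<n. \<forall>j<n. M $$ (i, j) = (\<Sum>k<r. a i k * b k j)"
    using real_rank_factorization[OF M rank] by (elim exE) (rule that)
  then have fact: "A i j = (\<Sum>k<r. a i k * b k j)" if "i \<in> {..<n}" "j \<in> {..<n}" for i j
    using that by (simp add: A_def)
  define p where "p = density M"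
  have "(\<Sum>i<n. \<Sum>j<n. A i j) = (\<Sum>(i, j)\<in>{..<n} \<times> {..<n}. A i j)"
    by (simp add: sum.cartesian_product)
  also have "\<dots> = (\<Sum>x\<in>{..<n} \<times> {..<n}. if case x of (i, j) \<Rightarrow> M $$ (i, j) = 1 then 1 else 0)"
    using A01 by (intro sum.cong) (auto simp: A_def)
  also have "\<dots> = real (card {x\<in>{..<n} \<times> {..<n}. case x of (i, j) \<Rightarrow> M $$ (i, j) = 1})"
    by (subst sum.inter_filter[symmetric]) auto
  also have "{x\<in>{..<n} \<times> {..<n}. case x of (i, j) \<Rightarrow> M $$ (i, j) = 1}
      = {(i, j). i < dim_row M \<and> j < dim_col M \<and> M $$ (i, j) = 1}"
    using M by auto
  also have "real (card \<dots>) = p * card {..<n} * card {..<n}"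
    using M n by (simp add: p_def density_def power2_eq_square)
  finally have p: "(\<Sum>i<n. \<Sum>j<n. A i j) = p * card {..<n} * card {..<n}" .
  have p01: "p \<ge> 0" "p \<le> 1 / 2"
    using density by (auto simp: p_def density_def)
  have "\<exists>X'\<subseteq>{..<n}. \<exists>Y'\<subseteq>{..<n}. X' \<noteq> {} \<and> Y' \<noteq> {} \<and>
    4 * real r * (\<Sum>i\<in>X'. \<Sum>j\<in>Y'. A i j) \<le> real (card X') * real (card Y') \<and>
    card {..<n} * exp (- 20000 * sqrt (r * p)) \<le> card X' \<and> card {..<n} * exp (- 20000 * sqrt (r * p)) \<le> card Y'"
  proof (rule sparse_subrectangle)
    show "A i j \<in> {0, 1}" if "i \<in> {..<n}" "j \<in> {..<n}" for i j
      using that by (rule A01)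
    show "A i j = (\<Sum>k<r. a i k * b k j)" if "i \<in> {..<n}" "j \<in> {..<n}" for i j
      using that by (rule fact)
  qed (use p p01 r n in auto)
  then obtain X Y where XY: "X \<subseteq> {..<n}" "Y \<subseteq> {..<n}" "X \<noteq> {}" "Y \<noteq> {}"
    "4 * real r * (\<Sum>i\<in>X. \<Sum>j\<in>Y. A i j) \<le> real (card X) * real (card Y)"
    "card {..<n} * exp (- 20000 * sqrt (r * p)) \<le> card X" "card {..<n} * exp (- 20000 * sqrt (r * p)) \<le> card Y"
    by (elim exE conjE) (rule that)
  have "\<exists>X'\<subseteq>X. \<exists>Y'\<subseteq>Y. (\<forall>i\<in>X'. \<forall>j\<in>Y'. A i j = 0) \<and>
    real (card X) \<le> 2 * real (card X') \<and> real (card Y) \<le> 2 * real (card Y')"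
  proof (rule sparse_zero_rectangle)
    show "finite X" "finite Y" using XY(1,2) by (auto intro: finite_subset)
    show "A i j \<in> {0, 1}" if "i \<in> X" "j \<in> Y" for i j
      using that XY by (intro A01) auto
    show "A i j = (\<Sum>k<r. a i k * b k j)" if "i \<in> X" "j \<in> Y" for i j
      using that XY by (intro fact) auto
  qed (rule XY r)+
  then obtain X' Y' where XY': "X' \<subseteq> X" "Y' \<subseteq> Y" "\<forall>i\<in>X'. \<forall>j\<in>Y'. A i j = 0"
    "real (card X) \<le> 2 * real (card X')" "real (card Y) \<le> 2 * real (card Y')"
    by (elim exE conjE) (rule that)
  have rect: "zero_rect M X' Y'"
    using XY XY' M unfolding zero_rect_def A_def by auto
  have "exp (- 20000 * sqrt r) \<le> exp (- 20000 * sqrt (r * p))"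
    using p01 by (simp add: mult_left_le)
  then have "real n * exp (- 20000 * sqrt r) \<le> real n * exp (- 20000 * sqrt (r * p))"
    by (intro mult_left_mono) auto
  also have "\<dots> \<le> 2 * min (real (card X')) (real (card Y'))"
    using XY(6,7) XY'(4,5) by (auto simp: min_def)
  also have "\<dots> \<le> 2 * real (zarank M)"
    using zarank_ge[OF rect, of "min (card X') (card Y')"] by (auto simp: min_def)
  finally show ?thesis .
qed

theorem theorem4p2:
  "\<exists>c::real. c > 0 \<and>
     (\<forall>(r::nat) (n::nat) (M::real mat).
        r > 0 \<longrightarrow> M \<in> carrier_mat n n \<longrightarrow> zero_one_mat M \<longrightarrow>
        real_rank M \<le> r \<longrightarrow> density M \<le> 1/2 \<longrightarrow>
        real (zarank M) \<ge> real n / 2 powr (c * sqrt (real r)))"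
proof (intro exI[of _ "20001 / ln 2"] conjI allI impI)
  show "20001 / ln 2 > (0::real)" by simp
next
  fix r n :: nat and M :: "real mat"
  assume r: "r > 0" and hyps: "M \<in> carrier_mat n n" "zero_one_mat M" "real_rank M \<le> r" "density M \<le> 1 / 2"
  show "real (zarank M) \<ge> real n / 2 powr (20001 / ln 2 * sqrt (real r))"
  proof (cases "n = 0")
    case False
    \<comment> \<open>The step from 20000 to 20001 absorbs the factor 2, since
      \<open>r \<ge> 1\<close> gives \<open>2 \<le> exp (sqrt r)\<close>; division by
      \<open>ln 2\<close> changes the base of the power from e to 2.\<close>
    have "2 \<le> exp (1 :: real)"
      using exp_ge_add_one_self[of 1] by simp
    also have "\<dots> \<le> exp (sqrt r)"
      using r by simp
    finally have "exp (- 20001 * sqrt r) * 2 \<le> exp (- 20001 * sqrt r) * exp (sqrt r)"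
      by (intro mult_left_mono) auto
    also have "\<dots> = exp (- 20000 * sqrt r)"
      by (simp flip: exp_add)
    finally have "real n * (exp (- 20001 * sqrt r) * 2) \<le> real n * exp (- 20000 * sqrt r)"
      by (intro mult_left_mono) auto
    also have "\<dots> \<le> 2 * real (zarank M)"
      using zarank_lower_bound[OF r hyps] False by simp
    finally have "real n * exp (- 20001 * sqrt r) \<le> real (zarank M)"
      by simp
    moreover have "2 powr (20001 / ln 2 * sqrt r) = exp (20001 * sqrt r)"
      by (simp add: powr_def)
    ultimately show ?thesis
      by (simp add: exp_minus divide_inverse)
  qed simp
qed

end
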